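(* Let $\Delta=\partial(\sigma_{d+1})$ with $d\in\mathbb{N}$. Then $$\dim P_\Delta=\begin{cases}d,&\text{if }d\text{ is even},\\ d+1,&\text{if }d\text{ is odd}.\end{cases}$$
   Context: $\mathbb{N}$ includes $0$. Let $\sigma_{d+1}=2^{[d+2]}$ be the full simplex on vertex set $[d+2]=\{1<2<\dots<d+2\}$ and $\partial(\sigma_{d+1})=\sigma_{d+1}\setminus\{[d+2]\}$ its boundary, a $d$-dimensional simplicial complex. For a simplicial complex $\Delta$ on an ordered vertex set, $C_i(\Delta)$ is the $\mathbb{Q}$-vector space with basis $e_\sigma$, $\sigma$ an $i$-dimensional face, with $C_i(\Delta)=0$ for $i\le -1$ and $i>\dim\Delta$; the boundary map $\partial_i:C_i(\Delta)\to C_{i-1}(\Delta)$ is $\partial_i(e_\sigma)=\sum_{k=1}^{i+1}(-1)^{k-1}e_{\sigma\setminus\{j_k\}}$ for $\sigma=\{j_1<\dots<j_{i+1}\}$ (so $\partial_0=0$). The $i$-th Laplacian matrix is $\mathcal{L}_i(\Delta)=\partial_{i+1}\partial_{i+1}^{\top}+\partial_i^{\top}\partial_i$. For $\Delta=\partial(\sigma_{d+1})$ the rows and columns of $\mathcal{L}_d(\Delta)\in\mathbb{Z}^{(d+2)\times(d+2)}$ are ordered according to the facets $F_1,\dots,F_{d+2}$, where $F_i=[d+2]\setminus\{d+3-i\}$. $P_{\Delta}\subseteq\mathbb{R}^{d+2}$ is the convex hull of the columns of $\mathcal{L}_d(\Delta)$. *)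

theory Defs
  imports "HOL-Analysis.Analysis" "HOL-Library.Poly_Mapping"
begin

text \<open>A simplicial complex is a set of finite vertex sets. The dimension \<open>i\<close> ranges over the
  integers; since \<open>C\<^sub>-\<^sub>1 = 0\<close> (unreduced chains), the empty set is not an indexing face in
  dimension \<open>-1\<close>.\<close>

definition faces_of_dim :: "'a set set \<Rightarrow> int \<Rightarrow> 'a set set" where
  "faces_of_dim \<Delta> i = (if i < 0 then {} else {\<sigma> \<in> \<Delta>. finite \<sigma> \<and> int (card \<sigma>) = i + 1})"

text \<open>The basis vector \<open>e\<^sub>\<sigma>\<close> is \<open>Poly_Mapping.single \<sigma> 1\<close>.\<close>

definition chain_space :: "'a set set \<Rightarrow> int \<Rightarrow> ('a set \<Rightarrow>\<^sub>0 rat) set" where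
  "chain_space \<Delta> i = {c. Poly_Mapping.keys c \<subseteq> faces_of_dim \<Delta> i}"

text \<open>The vertices \<open>j\<^sub>1 < \<dots> < j\<^sub>i\<^sub>+\<^sub>1\<close> of \<open>\<sigma>\<close> are the entries of
  \<open>sorted_list_of_set \<sigma>\<close>, which is indexed from \<open>0\<close>.\<close>

definition boundary_of_basis :: "int \<Rightarrow> 'a::linorder set \<Rightarrow> ('a set \<Rightarrow>\<^sub>0 rat)" where
  "boundary_of_basis i \<sigma> =
    (if i \<le> 0 then 0
     else \<Sum>k = 1..nat (i + 1).
       Poly_Mapping.single (\<sigma> - {sorted_list_of_set \<sigma> ! (k - 1)}) ((-1) ^ (k - 1)))"

definition boundary_map :: "int \<Rightarrow> ('a::linorder set \<Rightarrow>\<^sub>0 rat) \<Rightarrow> ('a set \<Rightarrow>\<^sub>0 rat)" where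
  "boundary_map i c =
    (\<Sum>\<sigma>\<in>Poly_Mapping.keys c.
      Poly_Mapping.map ((*) (Poly_Mapping.lookup c \<sigma>)) (boundary_of_basis i \<sigma>))"

lemma boundary_map_basis:
  "boundary_map i (Poly_Mapping.single \<sigma> 1) = boundary_of_basis i \<sigma>"
  by (simp add: boundary_map_def poly_mapping_eq_iff fun_eq_iff Poly_Mapping.map.rep_eq when_def)

lemma boundary_map_chain_space:
  assumes sub: "\<And>\<sigma> \<tau>. \<sigma> \<in> \<Delta> \<Longrightarrow> \<tau> \<subseteq> \<sigma> \<Longrightarrow> \<tau> \<in> \<Delta>"
    and c: "c \<in> chain_space \<Delta> i"
  shows "boundary_map i c \<in> chain_space \<Delta> (i - 1)"
proof -
  have basis: "Poly_Mapping.keys (boundary_of_basis i \<sigma>) \<subseteq> faces_of_dim \<Delta> (i - 1)"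
    if \<sigma>: "\<sigma> \<in> faces_of_dim \<Delta> i" for \<sigma>
  proof (cases "i \<le> 0")
    case False
    have fin: "finite \<sigma>" and card: "int (card \<sigma>) = i + 1" and mem: "\<sigma> \<in> \<Delta>"
      using \<sigma> False by (auto simp: faces_of_dim_def)
    have "\<sigma> - {sorted_list_of_set \<sigma> ! (k - 1)} \<in> faces_of_dim \<Delta> (i - 1)"
      if k: "k \<in> {1..nat (i + 1)}" for k
    proof -
      have "k - 1 < length (sorted_list_of_set \<sigma>)"
        using k card by auto
      then have "sorted_list_of_set \<sigma> ! (k - 1) \<in> \<sigma>"
        using nth_mem[of "k - 1" "sorted_list_of_set \<sigma>"] set_sorted_list_of_set[OF fin] by simp
      then have "int (card (\<sigma> - {sorted_list_of_set \<sigma> ! (k - 1)})) = i"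
        using card card_Suc_Diff1[OF fin] by force
      moreover have "\<sigma> - {sorted_list_of_set \<sigma> ! (k - 1)} \<in> \<Delta>"
        using mem by (rule sub) blast
      ultimately show ?thesis
        using fin False by (simp add: faces_of_dim_def)
    qed
    then have "(\<Union>k\<in>{1..nat (i + 1)}. Poly_Mapping.keys
        (Poly_Mapping.single (\<sigma> - {sorted_list_of_set \<sigma> ! (k - 1)}) ((-1) ^ (k - 1) :: rat)))
        \<subseteq> faces_of_dim \<Delta> (i - 1)"
      by (simp add: UN_subset_iff)
    then show ?thesis
      using False unfolding boundary_of_basis_def by (simp only: if_False order_trans[OF keys_sum])
  qed (simp add: boundary_of_basis_def)
  have map_keys: "Poly_Mapping.keys (Poly_Mapping.map ((*) a) p) \<subseteq> Poly_Mapping.keys p"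
    for a :: rat and p :: "'a set \<Rightarrow>\<^sub>0 rat"
    by (auto simp: Poly_Mapping.in_keys_iff Poly_Mapping.map.rep_eq when_def split: if_splits)
  have "(\<Union>\<sigma>\<in>Poly_Mapping.keys c. Poly_Mapping.keys
      (Poly_Mapping.map ((*) (Poly_Mapping.lookup c \<sigma>)) (boundary_of_basis i \<sigma>)))
      \<subseteq> faces_of_dim \<Delta> (i - 1)"
  proof (rule UN_least)
    fix \<sigma> assume "\<sigma> \<in> Poly_Mapping.keys c"
    then have "\<sigma> \<in> faces_of_dim \<Delta> i"
      using c by (auto simp: chain_space_def)
    then show "Poly_Mapping.keys
        (Poly_Mapping.map ((*) (Poly_Mapping.lookup c \<sigma>)) (boundary_of_basis i \<sigma>))
        \<subseteq> faces_of_dim \<Delta> (i - 1)"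
      using order_trans[OF map_keys basis] by blast
  qed
  then show ?thesis
    unfolding chain_space_def boundary_map_def mem_Collect_eq by (rule order_trans[OF keys_sum])
qed

text \<open>Matrix of \<open>\<partial>\<^sub>i\<close>: the entry in row \<open>\<tau>\<close> (an \<open>(i-1)\<close>-face) and column
  \<open>\<sigma>\<close> (an \<open>i\<close>-face).\<close>

definition boundary_matrix :: "int \<Rightarrow> 'a::linorder set \<Rightarrow> 'a set \<Rightarrow> rat" where
  "boundary_matrix i \<tau> \<sigma> =
    Poly_Mapping.lookup (boundary_map i (Poly_Mapping.single \<sigma> 1)) \<tau>"

text \<open>Rows and columns of the \<open>i\<close>-th Laplacian are indexed by the \<open>i\<close>-faces of \<open>\<Delta>\<close>.\<close>

definition laplacian :: "'a::linorder set set \<Rightarrow> int \<Rightarrow> 'a set \<Rightarrow> 'a set \<Rightarrow> rat" where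
  "laplacian \<Delta> i \<sigma> \<tau> =
    (\<Sum>\<rho>\<in>faces_of_dim \<Delta> (i + 1). boundary_matrix (i + 1) \<sigma> \<rho> * boundary_matrix (i + 1) \<tau> \<rho>)
    + (\<Sum>\<rho>\<in>faces_of_dim \<Delta> (i - 1). boundary_matrix i \<rho> \<sigma> * boundary_matrix i \<rho> \<tau>)"

definition boundary_simplex :: "nat \<Rightarrow> nat set set" where
  "boundary_simplex d = Pow {1..d + 2} - {{1..d + 2}}"

definition facet :: "nat \<Rightarrow> nat \<Rightarrow> nat set" where
  "facet d i = {1..d + 2} - {d + 3 - i}"

text \<open>The space \<open>\<real>\<^sup>d\<^sup>+\<^sup>2\<close> is \<open>real ^ 'n\<close>, where \<open>idx\<close> numbers the index type \<open>'n\<close> bijectively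
  by \<open>1, \<dots>, d + 2\<close>.\<close>

definition laplacian_matrix :: "nat \<Rightarrow> ('n::finite \<Rightarrow> nat) \<Rightarrow> real ^ 'n ^ 'n" where
  "laplacian_matrix d idx =
    (\<chi> r c. of_rat (laplacian (boundary_simplex d) (int d) (facet d (idx r)) (facet d (idx c))))"

definition laplacian_polytope :: "nat \<Rightarrow> ('n::finite \<Rightarrow> nat) \<Rightarrow> (real ^ 'n) set" where
  "laplacian_polytope d idx = convex hull (columns (laplacian_matrix d idx))"

end

(* For d >= 1 the Laplacian is L = (d + 2) I - v v^T with v = (-1, 1, -1, ...), so its columns span
   the hyperplane orthogonal to v, of dimension d + 1.  If d is odd, the entries of -v sum to 1 and
   L (-v) = 0, so 0 lies in the affine hull of the columns and the affine dimension is d + 1.  If d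
   is even, the entries of v sum to 0, so every column has coordinate sum d + 2; hence 0 is not in
   the affine hull and the affine dimension drops by one.  The case d = 0 is degenerate: there are
   no (-1)-chains, so L = 0. *)
theory Submission
  imports Defs
begin

text \<open>Sign of the ridge omitting \<open>a\<close> and \<open>b\<close> in the boundary of the facet omitting \<open>a\<close>: the vertex
  \<open>b\<close> has position \<open>b\<close> or \<open>b - 1\<close> in that facet, according to the side of \<open>a\<close> it lies on.\<close>

definition incidence_sign :: "nat \<Rightarrow> nat \<Rightarrow> rat" where
  "incidence_sign a b = (if b < a then (-1) ^ (b - 1) else (-1) ^ b)"

lemma incidence_sign_square: "incidence_sign a b * incidence_sign a b = 1"
  by (simp add: incidence_sign_def flip: power_add mult_2)

text \<open>Exactly one of \<open>a\<close>, \<open>c\<close> is the smaller, so exactly one of the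
  two factors has its exponent lowered by one. Positivity keeps that \<open>- 1\<close> from
  truncating at 0.\<close>

lemma incidence_sign_antisym:
  assumes "a \<noteq> c" "0 < a" "0 < c"
  shows "incidence_sign a c * incidence_sign c a = - ((-1) ^ (a + c))"
proof -
  obtain a' c' where "a = Suc a'" "c = Suc c'"
    using assms by (metis gr0_implies_Suc)
  then show ?thesis
    using assms by (auto simp: incidence_sign_def power_add)
qed

section \<open>Boundary of a facet\<close>

lemma sorted_list_of_set_atLeastAtMost_remove:
  fixes a n :: nat
  assumes "a \<in> {1..n}"
  shows "sorted_list_of_set ({1..n} - {a}) = [1..<a] @ [Suc a..<Suc n]"
proof -
  have "set ([1..<a] @ [Suc a..<Suc n]) = {1..n} - {a}"
    using assms by auto
  moreover have "sorted ([1..<a] @ [Suc a..<Suc n])" "distinct ([1..<a] @ [Suc a..<Suc n])"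
    by (auto simp: sorted_append)
  ultimately show ?thesis
    by (metis sorted_list_of_set.idem_if_sorted_distinct)
qed

text \<open>The sum is reindexed by the removed vertex \<open>b\<close> instead of its position, so
  that ridges of different facets become comparable.\<close>

lemma boundary_of_basis_facet:
  assumes "a \<in> {1..d + 2}" "d \<ge> 1"
  shows "boundary_of_basis (int d) ({1..d + 2} - {a}) =
    (\<Sum>b\<in>{1..d + 2} - {a}. Poly_Mapping.single ({1..d + 2} - {a, b}) (incidence_sign a b))"
proof -
  let ?l = "[1..<a] @ [Suc a..<Suc (d + 2)]"
  \<comment> \<open>\<open>f k\<close> is the \<open>k\<close>-th vertex of the facet: vertices
    beyond the gap at \<open>a\<close> are shifted by one.\<close>
  define f where "f k = (if k < a then k else Suc k)" for k
  have nth: "?l ! (k - 1) = f k" if "k \<in> {1..d + 1}" for k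
    using assms that by (auto simp: nth_append f_def)
  have sign: "incidence_sign a (f k) = (-1) ^ (k - 1)" if "k \<in> {1..d + 1}" for k
    using that by (cases k) (auto simp: incidence_sign_def f_def)
  have "bij_betw f {1..d + 1} ({1..d + 2} - {a})"
    using assms
    by (intro bij_betwI[where g = "\<lambda>b. if b < a then b else b - 1"]) (auto simp: f_def split: if_splits)
  note reindex = sum.reindex_bij_betw[OF this, symmetric]
  have "nat (int d + 1) = d + 1"
    by simp
  then have "boundary_of_basis (int d) ({1..d + 2} - {a}) =
    (\<Sum>k = 1..d + 1. Poly_Mapping.single ({1..d + 2} - {a} - {?l ! (k - 1)}) ((-1) ^ (k - 1)))"
    using assms unfolding boundary_of_basis_def
    by (simp only: sorted_list_of_set_atLeastAtMost_remove[OF assms(1)]) simp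
  also have "\<dots> = (\<Sum>k = 1..d + 1.
      Poly_Mapping.single ({1..d + 2} - {a, f k}) (incidence_sign a (f k)))"
    by (intro sum.cong refl) (simp only: nth sign Diff_insert2[symmetric])
  also have "\<dots> =
    (\<Sum>b\<in>{1..d + 2} - {a}. Poly_Mapping.single ({1..d + 2} - {a, b}) (incidence_sign a b))"
    by (rule reindex[symmetric])
  finally show ?thesis .
qed

lemma boundary_matrix_facet:
  assumes "a \<in> {1..d + 2}" "d \<ge> 1"
  shows "boundary_matrix (int d) \<rho> ({1..d + 2} - {a}) =
    (\<Sum>b\<in>{1..d + 2} - {a}. if {1..d + 2} - {a, b} = \<rho> then incidence_sign a b else 0)"
  unfolding boundary_matrix_def boundary_map_basis boundary_of_basis_facet[OF assms]
  by (simp only: lookup_sum lookup_single when_def)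

section \<open>Entries of the Laplacian\<close>

lemma faces_of_dim_boundary_simplex_top:
  "faces_of_dim (boundary_simplex d) (int d + 1) = {}"
proof -
  \<comment> \<open>Such a face would be the full vertex set, the one set deleted from the simplex.
    Hence the first sum in the Laplacian vanishes.\<close>
  have "\<sigma> = {1..d + 2}" if "\<sigma> \<subseteq> {1..d + 2}" "int (card \<sigma>) = int d + 1 + 1" for \<sigma>
    using that by (intro card_subset_eq) auto
  then show ?thesis
    unfolding faces_of_dim_def boundary_simplex_def by (simp del: One_nat_def) blast
qed

lemma ridge_mem_faces_of_dim:
  assumes "a \<in> {1..d + 2}" "b \<in> {1..d + 2}" "a \<noteq> b" "d \<ge> 1"
  shows "{1..d + 2} - {a, b} \<in> faces_of_dim (boundary_simplex d) (int d - 1)"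
proof -
  have "card ({1..d + 2} - {a, b}) = d"
    using assms by (subst card_Diff_subset) auto
  moreover have "{1..d + 2} - {a, b} \<noteq> {1..d + 2}"
    using assms(1) by blast
  ultimately show ?thesis
    using assms(4) by (simp add: faces_of_dim_def boundary_simplex_def del: One_nat_def)
qed

lemma finite_faces_of_dim_boundary_simplex [simp]:
  "finite (faces_of_dim (boundary_simplex d) i)"
  by (rule finite_subset[of _ "Pow {1..d + 2}"]) (auto simp: faces_of_dim_def boundary_simplex_def)

text \<open>Entries count common ridges with sign. A facet has \<open>d + 1\<close> ridges, each
  contributing a square 1; two distinct facets share only the ridge omitting both \<open>a\<close>
  and \<open>c\<close>, whose sign comes from \<open>incidence_sign_antisym\<close>.\<close>

lemma laplacian_boundary_simplex:
  assumes a: "a \<in> {1..d + 2}" and c: "c \<in> {1..d + 2}" and d: "d \<ge> 1"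
  shows "laplacian (boundary_simplex d) (int d) ({1..d + 2} - {a}) ({1..d + 2} - {c}) =
    (if a = c then of_nat d + 2 else 0) - (-1) ^ (a + c)"
proof -
  let ?V = "{1..d + 2}"
  let ?R = "faces_of_dim (boundary_simplex d) (int d - 1)"
  let ?s = incidence_sign
  have "laplacian (boundary_simplex d) (int d) (?V - {a}) (?V - {c}) =
      (\<Sum>\<rho>\<in>?R. \<Sum>b\<in>?V - {a}. \<Sum>b'\<in>?V - {c}.
        if ?V - {a, b} = \<rho> \<and> ?V - {c, b'} = \<rho> then ?s a b * ?s c b' else 0)"
    unfolding laplacian_def faces_of_dim_boundary_simplex_top boundary_matrix_facet[OF a d]
      boundary_matrix_facet[OF c d] sum_product
    by (simp, intro sum.cong refl) auto
  \<comment> \<open>With the ridge sum innermost, the condition fixes \<rho>, so each pair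
    \<open>b\<close>, \<open>b'\<close> contributes at most one term.\<close>
  also have "\<dots> = (\<Sum>b\<in>?V - {a}. \<Sum>b'\<in>?V - {c}. \<Sum>\<rho>\<in>?R.
        if ?V - {a, b} = \<rho> \<and> ?V - {c, b'} = \<rho> then ?s a b * ?s c b' else 0)"
    by (subst sum.swap, intro sum.cong refl, rule sum.swap)
  also have "\<dots> = (\<Sum>b\<in>?V - {a}. \<Sum>b'\<in>?V - {c}.
        if ?V - {c, b'} = ?V - {a, b} then ?s a b * ?s c b' else 0)"
  proof (intro sum.cong refl)
    fix b b' assume "b \<in> ?V - {a}" "b' \<in> ?V - {c}"
    then have "?V - {a, b} \<in> ?R"
      using a d by (intro ridge_mem_faces_of_dim) auto
    then have "(\<Sum>\<rho>\<in>?R. if ?V - {a, b} = \<rho> then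
        (if ?V - {c, b'} = \<rho> then ?s a b * ?s c b' else 0) else 0) =
        (if ?V - {c, b'} = ?V - {a, b} then ?s a b * ?s c b' else 0)"
      by (subst sum.delta') auto
    then show "(\<Sum>\<rho>\<in>?R. if ?V - {a, b} = \<rho> \<and> ?V - {c, b'} = \<rho>
        then ?s a b * ?s c b' else 0) =
        (if ?V - {c, b'} = ?V - {a, b} then ?s a b * ?s c b' else 0)"
      by (simp only: if_if_eq_conj)
  qed
  also have "\<dots> = (if a = c then of_nat d + 2 else 0) - (-1) ^ (a + c)"
  proof (cases "a = c")
    case True
    have "?V - {c, b'} = ?V - {a, b} \<longleftrightarrow> b = b'" if "b \<in> ?V - {a}" "b' \<in> ?V - {c}" for b b'
      using True that by blast
    then have "(\<Sum>b\<in>?V - {a}. \<Sum>b'\<in>?V - {c}.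
        if ?V - {c, b'} = ?V - {a, b} then ?s a b * ?s c b' else 0) =
        (\<Sum>b\<in>?V - {a}. \<Sum>b'\<in>?V - {c}. if b = b' then ?s a b * ?s c b' else 0)"
      by (intro sum.cong refl if_cong) auto
    also have "\<dots> = (\<Sum>b\<in>?V - {a}. 1)"
      using True by (intro sum.cong refl) (simp add: incidence_sign_square)
    also have "\<dots> = of_nat d + 1"
      using a by simp
    \<comment> \<open>The count \<open>d + 1\<close> is \<open>d + 2\<close> minus
      \<open>(-1) ^ (a + a) = 1\<close>.\<close>
    finally show ?thesis
      using True by (simp flip: mult_2)
  next
    case False
    have "?V - {c, b'} = ?V - {a, b} \<longleftrightarrow> b = c \<and> b' = a"
      if "b \<in> ?V - {a}" "b' \<in> ?V - {c}" for b b'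
      using False that a c by blast
    then have "(\<Sum>b\<in>?V - {a}. \<Sum>b'\<in>?V - {c}.
        if ?V - {c, b'} = ?V - {a, b} then ?s a b * ?s c b' else 0) =
        (\<Sum>b\<in>?V - {a}. \<Sum>b'\<in>?V - {c}.
          if b' = a then if b = c then ?s a b * ?s c b' else 0 else 0)"
      by (intro sum.cong refl) auto
    also have "\<dots> = (\<Sum>b\<in>?V - {a}. if b = c then ?s a b * ?s c a else 0)"
      using False a by (intro sum.cong refl, subst sum.delta) auto
    also have "\<dots> = ?s a c * ?s c a"
      using False c by (subst sum.delta) auto
    finally show ?thesis
      using False a c by (simp add: incidence_sign_antisym)
  qed
  finally show ?thesis .
qed

section \<open>The matrix as an operator\<close>

lemma sum_alternating_sign:
  "(\<Sum>k = 1..d + 2. (-1) ^ k :: real) = (if even d then 0 else - 1)"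
  by (induction d) auto

definition sign_vector :: "('n::finite \<Rightarrow> nat) \<Rightarrow> real ^ 'n" where
  "sign_vector idx = (\<chi> i. (-1) ^ idx i)"

text \<open>Facet number \<open>i\<close> omits vertex \<open>d + 3 - i\<close>. Reversing both
  indices preserves the parity of their sum, so the numbering of the facets leaves the signs
  intact.\<close>

lemma laplacian_matrix_entry:
  assumes "bij_betw idx UNIV {1..d + 2}" "d \<ge> 1"
  shows "laplacian_matrix d idx $ r $ c =
    (if r = c then real d + 2 else 0) - sign_vector idx $ r * sign_vector idx $ c"
proof -
  have range: "idx i \<in> {1..d + 2}" for i
    using assms(1) by (auto simp: bij_betw_def)
  then have le: "idx i \<le> d + 2" "1 \<le> idx i" for i
    by auto
  have mem: "d + 3 - idx i \<in> {1..d + 2}" for i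
    unfolding atLeastAtMost_iff using le[of i] by linarith
  have "inj idx"
    using assms(1) by (simp add: bij_betw_def)
  have "d + 3 - idx r = d + 3 - idx c \<longleftrightarrow> idx r = idx c"
    using le[of r] le[of c] by linarith
  then have eq: "d + 3 - idx r = d + 3 - idx c \<longleftrightarrow> r = c"
    using \<open>inj idx\<close> by (simp add: inj_eq)
  \<comment> \<open>The bound \<open>idx i \<le> d + 2\<close> makes this a genuine
    subtraction.\<close>
  have "even (d + 3 - idx i) \<longleftrightarrow> even (d + 3 + idx i)" for i
    using le[of i] by (subst even_diff_nat) auto
  then have "even (d + 3 - idx r + (d + 3 - idx c)) \<longleftrightarrow> even (idx r + idx c)"
    by (simp only: even_add) blast
  then have "(-1 :: rat) ^ (d + 3 - idx r + (d + 3 - idx c)) = (-1) ^ (idx r + idx c)"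
    by (simp add: minus_one_power_iff)
  then have "laplacian (boundary_simplex d) (int d) (facet d (idx r)) (facet d (idx c)) =
      (if r = c then of_nat d + 2 else 0) - (-1) ^ idx r * (-1) ^ idx c"
    unfolding facet_def laplacian_boundary_simplex[OF mem mem assms(2)] eq
    by (simp only: power_add)
  then show ?thesis
    by (simp add: laplacian_matrix_def sign_vector_def of_rat_diff of_rat_add of_rat_power
        of_rat_minus of_rat_mult)
qed

lemma laplacian_matrix_mult:
  assumes "bij_betw idx UNIV {1..d + 2}" "d \<ge> 1"
  shows "laplacian_matrix d idx *v x =
    (real d + 2) *\<^sub>R x - (sign_vector idx \<bullet> x) *\<^sub>R sign_vector idx"
proof (rule vec_eq_iff[THEN iffD2, rule_format])
  fix r
  let ?v = "sign_vector idx"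
  have "(laplacian_matrix d idx *v x) $ r =
      (\<Sum>c\<in>UNIV. (if r = c then (real d + 2) * x $ c else 0) - ?v $ r * (?v $ c * x $ c))"
    unfolding matrix_vector_mult_def laplacian_matrix_entry[OF assms]
    by (simp add: left_diff_distrib mult.assoc if_distrib[of "\<lambda>t. t * _"] cong: if_cong)
  also have "\<dots> = (real d + 2) * x $ r - ?v $ r * (?v \<bullet> x)"
    by (simp add: sum_subtractf inner_vec_def flip: sum_distrib_left)
  finally show "(laplacian_matrix d idx *v x) $ r = ((real d + 2) *\<^sub>R x - (?v \<bullet> x) *\<^sub>R ?v) $ r"
    by simp
qed

section \<open>Affine dimension of the columns\<close>

lemma matrix_vector_mult_in_affine_hull_columns:
  fixes A :: "real ^ 'n ^ 'm"
  assumes "(\<Sum>i\<in>UNIV. x $ i) = 1"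
  shows "A *v x \<in> affine hull (columns A)"
proof -
  have fin: "finite (columns A)"
    by (simp add: columns_def full_SetCompr_eq)
  have sub: "(\<lambda>i. column i A) ` UNIV \<subseteq> columns A"
    by (auto simp: columns_def)
  \<comment> \<open>\<open>columns A\<close> is a set, so the coefficients of coinciding columns are
    pooled before forming the affine combination.\<close>
  define u where "u y = (\<Sum>i\<in>{i. column i A = y}. x $ i)" for y
  have "sum u (columns A) = 1"
    using sum.group[OF finite fin sub, of "\<lambda>i. x $ i"] assms by (simp add: u_def)
  moreover have "(\<Sum>y\<in>columns A. u y *\<^sub>R y) =
      (\<Sum>y\<in>columns A. \<Sum>i\<in>{i. column i A = y}. x $ i *\<^sub>R column i A)"
    by (simp add: u_def scaleR_sum_left)
  then have "(\<Sum>y\<in>columns A. u y *\<^sub>R y) = A *v x"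
    using sum.group[OF finite fin sub, of "\<lambda>i. x $ i *\<^sub>R column i A"]
    by (simp add: matrix_mult_sum scalar_mult_eq_scaleR)
  ultimately show ?thesis
    using affine_hull_finite[OF fin] by blast
qed

theorem lemma4p6:
  fixes d :: nat and idx :: "'n::finite \<Rightarrow> nat"
  assumes "bij_betw idx UNIV {1..d + 2}"
  shows "aff_dim (laplacian_polytope d idx) = (if even d then int d else int d + 1)"
proof (cases "d = 0")
  case True
  \<comment> \<open>Both sums are empty, there being no faces of dimension 1 or -1; the polytope is
    the single point 0.\<close>
  have "laplacian_matrix d idx = 0"
    by (simp add: True laplacian_matrix_def laplacian_def vec_eq_iff
        faces_of_dim_boundary_simplex_top[of 0, simplified] faces_of_dim_def[of _ "- 1"])
  then have "columns (laplacian_matrix d idx) = {0}"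
    by (auto simp: columns_def column_def vec_eq_iff)
  then show ?thesis
    using True by (simp add: laplacian_polytope_def)
next
  case False
  then have d: "d \<ge> 1"
    by simp
  let ?A = "laplacian_matrix d idx"
  define v where "v = sign_vector idx"
  note mult = laplacian_matrix_mult[OF assms d, folded v_def]
  have card: "CARD('n) = d + 2"
    using bij_betw_same_card[OF assms] by simp
  have vv: "v \<bullet> v = real d + 2"
    by (simp add: v_def sign_vector_def inner_vec_def card flip: power_mult_distrib)
  have sum_v: "(\<Sum>i\<in>UNIV. v $ i) = (if even d then 0 else - 1)"
    using sum.reindex_bij_betw[OF assms, of "\<lambda>k. (-1) ^ k :: real"] sum_alternating_sign[of d]
    by (simp add: v_def sign_vector_def)
  have columns: "\<exists>j. x = ?A *v axis j 1" if "x \<in> columns ?A" for x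
    using that by (auto simp: columns_def matrix_vector_mult_basis)
  have span: "span (columns ?A) = {x. v \<bullet> x = 0}"
  proof (rule antisym)
    have "columns ?A \<subseteq> {x. v \<bullet> x = 0}"
      using columns by (fastforce simp: mult inner_diff_right vv)
    then show "span (columns ?A) \<subseteq> {x. v \<bullet> x = 0}"
      by (intro span_minimal subspace_hyperplane)
    show "{x. v \<bullet> x = 0} \<subseteq> span (columns ?A)"
    proof
      fix x assume "x \<in> {x. v \<bullet> x = 0}"
      \<comment> \<open>On the hyperplane orthogonal to \<open>v\<close> the matrix acts as
        multiplication by \<open>d + 2\<close>, which gives the preimage.\<close>
      then have "?A *v ((1 / (real d + 2)) *\<^sub>R x) = x"
        by (simp add: mult)
      then show "x \<in> span (columns ?A)"
        by (metis matrix_vector_mult_in_columnspace)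
    qed
  qed
  have "v \<noteq> 0"
    using vv by auto
  then have dim: "int (dim (columns ?A)) = int d + 1"
    using dim_hyperplane[of v] card dim_span[of "columns ?A"] unfolding span by simp
  show ?thesis
  proof (cases "even d")
    case True
    \<comment> \<open>Here \<open>1\<close> is the all-ones vector, so the inner product with it is
      the coordinate sum.\<close>
    have "1 \<bullet> v = 0"
      using True sum_v by (simp add: inner_vec_def)
    then have "1 \<bullet> (?A *v axis j 1) = real d + 2" for j
      by (simp add: mult inner_diff_right inner_axis)
    then have "columns ?A \<subseteq> {x. 1 \<bullet> x = real d + 2}"
      using columns by fastforce
    then have "affine hull (columns ?A) \<subseteq> {x. 1 \<bullet> x = real d + 2}"
      by (intro hull_minimal affine_hyperplane)
    then have "0 \<notin> affine hull (columns ?A)"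
      by auto
    then have "aff_dim (insert 0 (columns ?A)) = aff_dim (columns ?A) + 1"
      by (simp add: aff_dim_insert)
    \<comment> \<open>Once 0 is adjoined, affine and linear dimension agree.\<close>
    moreover have "aff_dim (insert 0 (columns ?A)) = int d + 1"
      using dim aff_dim_zero[OF hull_inc[OF insertI1], of "columns ?A"]
      by (metis dim_span span_insert_0)
    ultimately show ?thesis
      using True unfolding laplacian_polytope_def aff_dim_convex_hull by simp
  next
    case odd: False
    have "?A *v (- v) \<in> affine hull (columns ?A)"
      using odd sum_v by (intro matrix_vector_mult_in_affine_hull_columns) (simp add: sum_negf)
    \<comment> \<open>The eigenvalue of \<open>v\<close> is \<open>d + 2\<close> minus
      \<open>v \<bullet> v\<close>, which is 0.\<close>
    also have "?A *v (- v) = 0"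
      by (simp add: mult vv scaleR_left_diff_distrib scaleR_left_distrib)
    finally have "aff_dim (columns ?A) = int (dim (columns ?A))"
      by (rule aff_dim_zero)
    then show ?thesis
      unfolding laplacian_polytope_def aff_dim_convex_hull using odd dim by simp
  qed
qed

end
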